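(* A sequence $(F_i)$ of sets in a Hilbert space $X$ is admissible for testing compactness if and only if it has the following two properties: (1) (Boundedness) We have $$\sup_i\ \sup_{f_i\in F_i}\|f_i\|_X<+\infty.$$ (2) (Asymptotic orthogonality) For every vector $f\in\bigcup_i F_i$ and for every sequence $f_i\in F_i$ we have $$\lim_{i\to\infty}\langle f_i,f\rangle=0.$$
   Context: $\langle\cdot,\cdot\rangle$ in (2) is the inner product of $X$. A sequence $(F_i)$ of sets in a Banach space $X$ is called admissible for testing compactness if $\limsup_{i\to\infty}\sup_{f_i\in F_i}\|Tf_i\|_Y=0$ for every Banach space $Y$ and every compact linear operator $T:X\to Y$.
   Formalization: Every F_i is assumed nonempty and bounded (not uniformly in i). Without this the claim fails: F_0 empty, F_i={e} with e a unit vector satisfies (1), (2) but is not admissible; F_0=X, F_i={0} for i≥1 is admissible but violates (1). *)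

theory Defs
  imports "HOL-Analysis.Analysis" "HOL-Algebra.Module"
begin

(* Scalars.  Up to isomorphism the only models are the reals with conjg x = x and the complex
   numbers with conjg = cnj: the last axiom makes z + conjg z = |1 + z|^2 - 1 - |z|^2 real, so every z
   is a root of the real quadratic X^2 - (z + conjg z) X + |z|^2. *)
class real_or_complex = real_normed_field + complete_space +
  fixes conjg :: "'a \<Rightarrow> 'a"
  assumes conjg_add: "conjg (x + y) = conjg x + conjg y"
    and mult_conjg: "x * conjg x = (norm x)\<^sup>2 *\<^sub>R 1"

instantiation real :: real_or_complex
begin
definition conjg_real :: "real \<Rightarrow> real" where "conjg_real x = x"
instance by standard (simp_all add: conjg_real_def power2_eq_square)
end

instantiation complex :: real_or_complex
begin
definition conjg_complex :: "complex \<Rightarrow> complex" where "conjg_complex = cnj"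
instance by standard (simp_all add: conjg_complex_def scaleR_conv_of_real complex_norm_square[symmetric])
end

(* A Hilbert space over 'k on the type 'a.  Norm and completeness are those of the class banach.
   The inner product is linear in the first argument. *)
locale hilbert_space = vector_space sc
  for sc :: "'k::real_or_complex \<Rightarrow> 'a::banach \<Rightarrow> 'a" +
  fixes ip :: "'a \<Rightarrow> 'a \<Rightarrow> 'k"
  assumes scale_of_real: "sc (of_real r) x = r *\<^sub>R x"
    and ip_add_left: "ip (x + y) z = ip x z + ip y z"
    and ip_scale_left: "ip (sc c x) y = c * ip x y"
    and ip_conjg: "ip y x = conjg (ip x y)"
    and ip_self: "ip x x = of_real ((norm x)\<^sup>2)"

lemma hilbert_space_real:
  "hilbert_space scaleR (inner :: 'a::{real_inner,banach} \<Rightarrow> 'a \<Rightarrow> real)"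
  by unfold_locales
    (simp_all add: algebra_simps conjg_real_def inner_commute power2_norm_eq_inner)

lemma hilbert_space_complex: "hilbert_space (*) (\<lambda>x y :: complex. x * cnj y)"
  by unfold_locales
    (simp_all add: algebra_simps conjg_complex_def scaleR_conv_of_real complex_norm_square[symmetric])

definition scalar_ring :: "'k::real_or_complex ring" where
  "scalar_ring = \<lparr>carrier = UNIV, monoid.mult = (*), one = 1, ring.zero = 0, add = (+)\<rparr>"

(* Target spaces live on a subset (the carrier) of a type 'u, so that one formula can quantify over
   all of them. *)
locale normed_space_on = Module.module scalar_ring Y
  for Y :: "('k::real_or_complex, 'u) module" (structure) +
  fixes nrm :: "'u \<Rightarrow> real"
  assumes nrm_eq_0: "x \<in> carrier Y \<Longrightarrow> nrm x = 0 \<longleftrightarrow> x = \<zero>"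
    and nrm_smult: "x \<in> carrier Y \<Longrightarrow> nrm (c \<odot> x) = norm c * nrm x"
    and nrm_triangle: "\<lbrakk>x \<in> carrier Y; y \<in> carrier Y\<rbrakk> \<Longrightarrow> nrm (x \<oplus> y) \<le> nrm x + nrm y"

(* The value 0 off the carrier is needed because the locale Metric_space asks for a nonnegative
   symmetric function on the whole type. *)
definition dist_on :: "('k, 'u) module \<Rightarrow> ('u \<Rightarrow> real) \<Rightarrow> 'u \<Rightarrow> 'u \<Rightarrow> real" where
  "dist_on Y nrm x y = (if x \<in> carrier Y \<and> y \<in> carrier Y then nrm (x \<ominus>\<^bsub>Y\<^esub> y) else 0)"

lemma (in normed_space_on) metric_space_dist_on: "Metric_space (carrier Y) (dist_on Y nrm)"
proof -
  have uminus: "\<ominus> x = (- 1) \<odot> x" if "x \<in> carrier Y" for x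
  proof -
    have "((1::'k) + (- 1)) \<odot> x = 1 \<odot> x \<oplus> (- 1) \<odot> x"
      using smult_l_distr[of 1 "- 1" x] that by (simp add: scalar_ring_def)
    moreover have "(1::'k) \<odot> x = x"
      using smult_one[of x] that by (simp add: scalar_ring_def)
    moreover have "(0::'k) \<odot> x = \<zero>"
      using smult_l_null[of x] that by (simp add: scalar_ring_def)
    moreover have "(- 1) \<odot> x \<in> carrier Y"
      using smult_closed[of "- 1" x] that by (simp add: scalar_ring_def)
    ultimately have "x \<oplus> (- 1) \<odot> x = \<zero>"
      by (metis add.right_inverse)
    with \<open>(- 1) \<odot> x \<in> carrier Y\<close> that show ?thesis
      by (metis M.minus_equality M.a_comm)
  qed
  have nrm_uminus: "nrm (\<ominus> x) = nrm x" if "x \<in> carrier Y" for x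
    using that by (simp add: uminus nrm_smult)
  have nonneg: "0 \<le> nrm x" if "x \<in> carrier Y" for x
  proof -
    have "nrm (x \<oplus> \<ominus> x) \<le> nrm x + nrm (\<ominus> x)"
      by (rule nrm_triangle) (use that in auto)
    then show ?thesis
      using that nrm_eq_0[of \<zero>] by (simp add: nrm_uminus M.r_neg)
  qed
  have comm: "nrm (x \<ominus> y) = nrm (y \<ominus> x)" if "x \<in> carrier Y" "y \<in> carrier Y" for x y
  proof -
    have "\<ominus> (x \<ominus> y) = y \<ominus> x"
      using that by (simp add: M.minus_eq M.minus_add M.a_comm)
    then show ?thesis
      using nrm_uminus[of "x \<ominus> y"] that by simp
  qed
  have minus_eq_0: "x \<ominus> y = \<zero> \<longleftrightarrow> x = y" if "x \<in> carrier Y" "y \<in> carrier Y" for x y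
    using that by (metis M.minus_eq M.r_neg M.a_inv_closed M.minus_equality M.minus_minus)
  show ?thesis
  proof
    fix x y z assume xyz: "x \<in> carrier Y" "y \<in> carrier Y" "z \<in> carrier Y"
    have "x \<ominus> z = (x \<ominus> y) \<oplus> (y \<ominus> z)"
      using xyz by (simp add: M.minus_eq M.a_assoc M.r_neg2 M.r_neg1)
    then show "dist_on Y nrm x z \<le> dist_on Y nrm x y + dist_on Y nrm y z"
      using xyz nrm_triangle[of "x \<ominus> y" "y \<ominus> z"] by (simp add: dist_on_def)
  qed (use nonneg comm nrm_eq_0 in \<open>auto simp: dist_on_def minus_eq_0\<close>)
qed

locale banach_space_on = normed_space_on +
  assumes complete: "Metric_space.mcomplete (carrier Y) (dist_on Y nrm)"

definition linear_into ::
    "('k::real_or_complex \<Rightarrow> 'a::banach \<Rightarrow> 'a) \<Rightarrow> ('k, 'u) module \<Rightarrow> ('a \<Rightarrow> 'u) \<Rightarrow> bool" where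
  "linear_into sc Y T \<longleftrightarrow>
     (\<forall>x. T x \<in> carrier Y) \<and>
     (\<forall>x y. T (x + y) = T x \<oplus>\<^bsub>Y\<^esub> T y) \<and>
     (\<forall>c x. T (sc c x) = c \<odot>\<^bsub>Y\<^esub> T x)"

definition compact_operator ::
    "('k::real_or_complex \<Rightarrow> 'a::banach \<Rightarrow> 'a) \<Rightarrow> ('k, 'u) module \<Rightarrow> ('u \<Rightarrow> real)
      \<Rightarrow> ('a \<Rightarrow> 'u) \<Rightarrow> bool" where
  "compact_operator sc Y nrm T \<longleftrightarrow>
     linear_into sc Y T \<and>
     (let \<tau> = Metric_space.mtopology (carrier Y) (dist_on Y nrm)
      in \<forall>B. bounded B \<longrightarrow> compactin \<tau> (Abstract_Topology.closure_of \<tau> (T ` B)))"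

(* HOL cannot quantify over types inside a formula, so "every Banach space Y" reads "every Banach
   space whose underlying set is a subset of the type 'u".  A theorem about it should leave 'u
   arbitrary, which covers every Banach space; it may have to require that the scalars 'k inject into
   'u, since otherwise 'u carries no Banach space other than 0. *)
definition admissible ::
    "'u itself \<Rightarrow> ('k::real_or_complex \<Rightarrow> 'a::banach \<Rightarrow> 'a) \<Rightarrow> (nat \<Rightarrow> 'a set) \<Rightarrow> bool" where
  "admissible U sc F \<longleftrightarrow>
     (\<forall>(Y :: ('k, 'u) module) nrm T.
        banach_space_on Y nrm \<longrightarrow> compact_operator sc Y nrm T \<longrightarrow>
        limsup (\<lambda>i. SUP f\<in>F i. ereal (nrm (T f))) = 0)"

end

(* Necessity: the functionals x |-> <x, f> are compact operators into the scalar field, so admissible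
   sequences are weakly null, and Banach-Steinhaus bounds a choice of nearly longest vectors.
   Sufficiency is a Banach-Saks argument which needs neither adjoints nor weak convergence: along
   nearly maximizing f_i in F_i the inner products <f_i, f_j> tend to 0 in i for each fixed j, so
   suitable arithmetic means of any subsequence tend to 0 in norm; if |T f_i| did not tend to 0,
   compactness would give a subsequence with the T f_i close to each other and far from 0, and T
   would map its means far from 0. *)

theory Submission
  imports Defs
begin

section \<open>Conjugation, real coordinates, and compactness of closed balls of scalars\<close>

section \<open>The scalars\<close>

lemma conjg_1: "conjg 1 = (1 :: 'k::real_or_complex)"
  using mult_conjg[of "1::'k"] by simp

lemma conjg_0: "conjg 0 = (0 :: 'k::real_or_complex)"
  using conjg_add[of "0::'k" 0] by simp

lemma norm_conjg: "norm (conjg z) = norm (z :: 'k::real_or_complex)"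
proof (cases "z = 0")
  case False
  have "norm z * norm (conjg z) = (norm z)\<^sup>2"
    by (simp add: mult_conjg flip: norm_mult)
  with False show ?thesis by (simp add: power2_eq_square)
qed (simp add: conjg_0)

lemma conjg_of_real: "conjg (of_real r) = (of_real r :: 'k::real_or_complex)"
proof (cases "r = 0")
  case False
  have "of_real r * conjg (of_real r :: 'k) = of_real r * of_real r"
    by (simp add: mult_conjg scaleR_conv_of_real power2_eq_square)
  with False show ?thesis by (metis mult_left_cancel of_real_eq_0_iff)
qed (simp add: conjg_0)

text \<open>Multiplicativity follows from \<open>mult_conjg\<close>: for \<open>z * w\<close>
  nonzero, both sides are the cofactor of \<open>z * w\<close> in its squared norm.\<close>

lemma conjg_mult: "conjg (z * w) = conjg z * conjg (w :: 'k::real_or_complex)"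
proof (cases "z * w = 0")
  case False
  have "(z * w) * conjg (z * w) = (z * conjg z) * (w * conjg w)"
    unfolding mult_conjg by (simp add: norm_mult power_mult_distrib)
  then have "(z * w) * conjg (z * w) = (z * w) * (conjg z * conjg w)"
    by (simp add: algebra_simps)
  with False show ?thesis by (metis mult_left_cancel)
qed (auto simp: conjg_0)

lemma add_conjg_real:
  fixes z :: "'k::real_or_complex"
  shows "\<exists>t. z + conjg z = of_real t \<and> \<bar>t\<bar> \<le> 2 * norm z"
proof -
  define t where "t = (norm (1 + z))\<^sup>2 - 1 - (norm z)\<^sup>2"
  have "(1 + z) * conjg (1 + z) = 1 + z + conjg z + z * conjg z"
    by (simp add: conjg_add conjg_1 algebra_simps)
  then have eq: "z + conjg z = of_real t"
    by (simp add: mult_conjg t_def scaleR_conv_of_real algebra_simps)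
  have "\<bar>t\<bar> = norm (z + conjg z)"
    by (simp add: eq)
  also have "\<dots> \<le> 2 * norm z"
    using norm_triangle_ineq[of z "conjg z"] by (simp add: norm_conjg)
  finally show ?thesis using eq by blast
qed

text \<open>Skew elements square to minus the square of their norm, so any two of them are real
  multiples of each other.\<close>

lemma scalars_two_dim:
  "\<exists>j::'k::real_or_complex. \<forall>z. \<exists>a b. z = of_real a + of_real b * j \<and>
    \<bar>a\<bar> \<le> norm z \<and> \<bar>b\<bar> \<le> 2 * norm z"
proof -
  define skew where "skew s \<longleftrightarrow> conjg s = - s" for s :: 'k
  \<comment> \<open>The real part is half of the trace \<open>z + conjg z\<close>; subtracting it
    leaves an element whose own trace is 0, that is, a skew one.\<close>
  have dec: "\<exists>a s. z = of_real a + s \<and> skew s \<and> \<bar>a\<bar> \<le> norm z \<and> norm s \<le> 2 * norm z" for z :: 'k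
  proof -
    obtain t where t: "z + conjg z = of_real t" "\<bar>t\<bar> \<le> 2 * norm z"
      using add_conjg_real by blast
    define s where "s = z - of_real (t/2)"
    have "z = of_real (t/2) + s" by (simp add: s_def)
    moreover have "conjg z = of_real (t/2) + conjg s"
      using conjg_add[of "of_real (t/2)" s] calculation by (simp only: conjg_of_real)
    ultimately have "of_real t = of_real (t/2) + of_real (t/2) + (s + conjg s)"
      using t(1) by simp
    then have "skew s"
      by (simp add: skew_def flip: of_real_add) (simp add: add_eq_0_iff)
    moreover have "norm s \<le> 2 * norm z"
      using norm_triangle_ineq4[of z "of_real (t/2)"] t(2) by (simp add: s_def)
    ultimately show ?thesis using t(2) \<open>z = of_real (t/2) + s\<close>
      by (intro exI[of _ "t/2"] exI[of _ s]) auto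
  qed
  have sq: "s * s = - of_real ((norm s)\<^sup>2)" if "skew s" for s
    using mult_conjg[of s] that by (simp add: skew_def scaleR_conv_of_real minus_equation_iff[of "s * s"])
  show ?thesis
  proof (cases "\<exists>s. skew s \<and> s \<noteq> 0")
    case True
    then obtain s0 where s0: "skew s0" "s0 \<noteq> 0" by blast
    define j where "j = s0 / of_real (norm s0)"
    have jj: "j * j = -1"
      using sq[OF s0(1)] s0(2) by (simp add: j_def power2_eq_square)
    have "\<exists>b. s = of_real b * j \<and> \<bar>b\<bar> = norm s" if "skew s" for s
    proof -
      \<comment> \<open>Both \<open>s\<close> and \<open>of_real (norm s) * j\<close> have square
        minus the squared norm of \<open>s\<close>, and in a field equal squares have roots equal up
        to sign.\<close>
      have "s * s = (of_real (norm s) * j) * (of_real (norm s) * j)"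
        using sq[OF that] jj by (simp add: power2_eq_square mult.assoc mult.left_commute[of j])
      then have "s = of_real (norm s) * j \<or> s = - (of_real (norm s) * j)"
        by (simp only: square_eq_iff)
      then show ?thesis
      proof
        assume "s = of_real (norm s) * j" then show ?thesis by (intro exI[of _ "norm s"]) simp
      next
        assume "s = - (of_real (norm s) * j)" then show ?thesis by (intro exI[of _ "- norm s"]) simp
      qed
    qed
    with dec show ?thesis by metis
  next
    case False
    \<comment> \<open>All scalars are real here, so 0 serves as a dummy second basis
      element.\<close>
    have "\<exists>a b. z = of_real a + of_real b * 0 \<and> \<bar>a\<bar> \<le> norm z \<and> \<bar>b\<bar> \<le> 2 * norm z" for z :: 'k
    proof -
      obtain a where "z = of_real a" "\<bar>a\<bar> \<le> norm z" using dec[of z] False by auto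
      then show ?thesis by (intro exI[of _ a] exI[of _ 0]) auto
    qed
    then show ?thesis by blast
  qed
qed

text \<open>Real coordinates reduce this to the plane: the ball is a closed part of the continuous
  image of a rectangle, whose sides come from the coefficient bounds in
  \<open>scalars_two_dim\<close>.\<close>

lemma compact_cball_scalars: "compact (cball (0::'k::real_or_complex) R)"
proof -
  obtain j :: 'k where j:
    "\<And>z. \<exists>a b. z = of_real a + of_real b * j \<and> \<bar>a\<bar> \<le> norm z \<and> \<bar>b\<bar> \<le> 2 * norm z"
    using scalars_two_dim by blast
  let ?g = "\<lambda>p::real \<times> real. of_real (fst p) + of_real (snd p) * j"
  let ?Q = "{-R..R} \<times> {-(2*R)..2*R}"
  have "compact (?g ` ?Q)"
    by (intro compact_continuous_image compact_Times compact_Icc continuous_intros)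
  moreover have "cball 0 R \<subseteq> ?g ` ?Q"
  proof
    fix z :: 'k assume "z \<in> cball 0 R"
    moreover obtain a b where "z = of_real a + of_real b * j" "\<bar>a\<bar> \<le> norm z" "\<bar>b\<bar> \<le> 2 * norm z"
      using j by blast
    ultimately show "z \<in> ?g ` ?Q"
      by (intro image_eqI[of _ _ "(a, b)"]) auto
  qed
  ultimately show ?thesis
    using compact_Int_closed[of "?g ` ?Q" "cball 0 R"] by (simp add: inf.absorb2)
qed

text \<open>The centres lie in \<open>A\<close> itself, so that a net of an image can later be
  lifted to points of the domain.\<close>

lemma bounded_scalars_net:
  fixes A :: "'k::real_or_complex set"
  assumes "bounded A" "0 < \<epsilon>"
  shows "\<exists>K. finite K \<and> K \<subseteq> A \<and> (\<forall>x\<in>A. \<exists>k\<in>K. dist k x < \<epsilon>)"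
proof -
  obtain R where "A \<subseteq> cball 0 R"
    using assms(1) by (auto simp: bounded_iff subset_iff)
  moreover have "Met_TC.mtotally_bounded (cball (0::'k) R)"
    by (simp add: Met_TC.compactin_imp_mtotally_bounded compact_cball_scalars)
  ultimately have "Met_TC.mtotally_bounded A"
    by (metis Met_TC.mtotally_bounded_subset)
  then obtain K where "finite K" "K \<subseteq> A" "A \<subseteq> (\<Union>x\<in>K. ball x \<epsilon>)"
    using assms(2) by (auto simp: Met_TC.mtotally_bounded_def)
  then have "\<forall>x\<in>A. \<exists>k\<in>K. dist k x < \<epsilon>"
    by (simp add: subset_iff Bex_def)
  with \<open>finite K\<close> \<open>K \<subseteq> A\<close> show ?thesis by blast
qed

section \<open>Cauchy-Schwarz, uniform boundedness, and sums of nearly orthogonal vectors\<close>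

section \<open>Inner products\<close>

context hilbert_space
begin

lemma ip_add_right: "ip x (y + z) = ip x y + ip x z"
  unfolding ip_conjg[of x] ip_add_left conjg_add ..

lemma ip_scale_right: "ip x (sc c y) = conjg c * ip x y"
  unfolding ip_conjg[of x] ip_scale_left conjg_mult ..

lemma norm_ip_commute: "norm (ip x y) = norm (ip y x)"
  by (subst ip_conjg) (simp add: norm_conjg)

lemma ip_zero_left: "ip 0 z = 0"
  using ip_add_left[of 0 0 z] by simp

lemma ip_diff_left: "ip (x - y) z = ip x z - ip y z"
  using ip_add_left[of "x - y" y z] by simp

lemma ip_sum_right: "ip x (\<Sum>i\<in>A. g i) = (\<Sum>i\<in>A. ip x (g i))"
proof -
  have "ip x 0 = 0" using ip_add_right[of x 0 0] by simp
  then show ?thesis by (induction A rule: infinite_finite_induct) (simp_all add: ip_add_right)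
qed

lemma norm_ip_self: "norm (ip x x) = (norm x)\<^sup>2"
  unfolding ip_self norm_of_real by simp

text \<open>The axioms tie \<open>sc\<close> to the norm directly only for real scalars; the general
  case is read off \<open>ip_self\<close>.\<close>

lemma norm_sc: "norm (sc c x) = norm c * norm x"
proof -
  have "of_real ((norm (sc c x))\<^sup>2) = c * conjg c * of_real ((norm x)\<^sup>2)"
    unfolding ip_self[symmetric] by (simp add: ip_scale_left ip_scale_right)
  also have "\<dots> = of_real ((norm c * norm x)\<^sup>2)"
    by (simp add: mult_conjg scaleR_conv_of_real power_mult_distrib)
  finally have "(norm (sc c x))\<^sup>2 = (norm c * norm x)\<^sup>2"
    by (simp only: of_real_eq_iff)
  then show ?thesis by simp
qed

text \<open>Pythagoras for the orthogonal projection \<open>sc c y\<close> of \<open>x\<close> onto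
  \<open>y\<close>: its norm is at most that of \<open>x\<close>, and it equals
  \<open>norm (ip x y) / norm y\<close>.\<close>

lemma cauchy_schwarz: "norm (ip x y) \<le> norm x * norm y"
proof (cases "y = 0")
  case True
  then show ?thesis using norm_ip_commute[of x y] by (simp add: ip_zero_left)
next
  case False
  define a where "a = ip x y"
  define n where "n = (norm y)\<^sup>2"
  have n: "n > 0" using False by (simp add: n_def)
  define c where "c = a / of_real n"
  define d where "d = x - sc c y"
  have x: "x = d + sc c y" by (simp add: d_def)
  have dy: "ip d y = 0"
    using n by (simp add: d_def ip_diff_left ip_scale_left ip_self c_def a_def n_def)
  have yd: "ip y d = 0"
    using dy ip_conjg[of y d] by (simp add: conjg_0)
  have "of_real ((norm x)\<^sup>2) = ip (d + sc c y) (d + sc c y)"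
    using x ip_self by simp
  also have "\<dots> = ip d d + ip (sc c y) (sc c y)"
    using dy yd by (simp add: ip_add_left ip_add_right ip_scale_left[of _ _ d] ip_scale_right[of d])
  also have "\<dots> = of_real ((norm d)\<^sup>2) + of_real ((norm (sc c y))\<^sup>2)"
    by (simp only: ip_self)
  finally have "(norm x)\<^sup>2 = (norm d)\<^sup>2 + (norm (sc c y))\<^sup>2"
    by (simp only: of_real_eq_iff flip: of_real_add)
  then have "(norm (sc c y))\<^sup>2 \<le> (norm x)\<^sup>2" by simp
  then have "norm c * norm y \<le> norm x" by (simp add: norm_sc)
  moreover have "norm c = norm (ip x y) / (norm y)\<^sup>2"
    unfolding c_def a_def n_def norm_divide norm_of_real by simp
  ultimately show ?thesis
    using False by (simp add: field_simps power2_eq_square)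
qed

lemma norm_add_square_le: "(norm (x + y))\<^sup>2 \<le> (norm x)\<^sup>2 + 2 * norm (ip y x) + (norm y)\<^sup>2"
proof -
  have "(norm (x + y))\<^sup>2 = norm (ip (x + y) (x + y))"
    by (simp add: norm_ip_self)
  also have "ip (x + y) (x + y) = ip x x + (ip x y + ip y x) + ip y y"
    by (simp add: ip_add_left ip_add_right)
  also have "norm \<dots> \<le> norm (ip x x) + (norm (ip x y) + norm (ip y x)) + norm (ip y y)"
    by (intro norm_triangle_mono order_refl)
  finally show ?thesis by (simp add: norm_ip_commute[of x y] norm_ip_self)
qed

lemma continuous_on_ip_right: "continuous_on UNIV (ip x)"
proof (rule continuous_onI)
  fix y and \<epsilon> :: real assume "\<epsilon> > 0"
  \<comment> \<open>The summand 1 keeps the denominator positive when \<open>x = 0\<close>.\<close>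
  define \<delta> where "\<delta> = \<epsilon> / (norm x + 1)"
  have "dist (ip x y') (ip x y) \<le> \<epsilon>" if "dist y' y < \<delta>" for y'
  proof -
    have "dist (ip x y') (ip x y) \<le> norm x * dist y' y"
      using cauchy_schwarz[of x "y' - y"] ip_add_right[of x "y' - y" y]
      by (simp add: dist_norm)
    also have "\<dots> \<le> (norm x + 1) * dist y' y" by (simp add: mult_right_mono)
    also have "\<dots> \<le> \<epsilon>"
      using that by (simp add: \<delta>_def pos_less_divide_eq mult.commute add_nonneg_pos)
    finally show ?thesis .
  qed
  moreover have "\<delta> > 0" using \<open>\<epsilon> > 0\<close> by (simp add: \<delta>_def add_nonneg_pos)
  ultimately show "\<exists>d>0. \<forall>y'\<in>UNIV. dist y' y < d \<longrightarrow> dist (ip x y') (ip x y) \<le> \<epsilon>"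
    by blast
qed

text \<open>Banach-Steinhaus for the maps \<open>ip (g i)\<close>, by Baire: some level set
  \<open>A n\<close> contains a ball, and testing on that ball in the direction of
  \<open>g i\<close> bounds \<open>norm (g i)\<close>.\<close>

lemma pointwise_bounded_imp_bounded:
  fixes g :: "nat \<Rightarrow> 'a"
  assumes "\<And>x. bounded (range (\<lambda>i. ip (g i) x))"
  shows "bounded (range g)"
proof -
  define A where "A n = (\<Inter>i. {x. norm (ip (g i) x) \<le> real n})" for n :: nat
  have closed: "closed (A n)" for n
    unfolding A_def
    by (intro closed_INT ballI closed_Collect_le continuous_intros continuous_on_ip_right)
  have "x \<in> (\<Union>n. A n)" for x
  proof -
    obtain b where "\<And>i. norm (ip (g i) x) \<le> b"
      using assms[of x] by (auto simp: bounded_iff)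
    moreover obtain n where "b \<le> real n" using real_arch_simple by blast
    ultimately have "x \<in> A n" by (auto simp: A_def intro: order_trans)
    then show ?thesis by blast
  qed
  then have "\<Union>(range A) = UNIV" by blast
  \<comment> \<open>Baire: if all these closed sets had empty interior, so would their union, which
    is the whole space.\<close>
  moreover have "euclidean interior_of \<Union>(range A) = {}" if "\<And>n. interior (A n) = {}"
    using closed that
    by (intro Baire_category_alt disjI1 completely_metrizable_space_euclidean) auto
  ultimately obtain n where "interior (A n) \<noteq> {}"
    by auto
  then obtain x0 r where r: "r > 0" "cball x0 r \<subseteq> A n"
    by (metis all_not_in_conv interior_subset mem_interior_cball)
  have "norm (g i) \<le> 2 * real n / r" for i
  proof (cases "g i = 0")
    case False
    \<comment> \<open>The vector of length \<open>r\<close> along \<open>g i\<close>, for which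
      Cauchy-Schwarz is an equality.\<close>
    define y where "y = sc (of_real (r / norm (g i))) (g i)"
    have "norm y = r" using False r by (simp add: y_def norm_sc norm_divide)
    then have "x0 + y \<in> A n" "x0 \<in> A n"
      using r by (auto simp: dist_norm subset_iff)
    then have "norm (ip (g i) (x0 + y)) \<le> n" "norm (ip (g i) x0) \<le> n"
      by (auto simp: A_def)
    moreover have "ip (g i) y = ip (g i) (x0 + y) - ip (g i) x0"
      by (simp add: ip_add_right)
    ultimately have "norm (ip (g i) y) \<le> 2 * n"
      using norm_triangle_ineq4[of "ip (g i) (x0 + y)" "ip (g i) x0"] by simp
    moreover have "norm (ip (g i) y) = r * norm (g i)"
    proof -
      have "norm (ip (g i) y) = norm (of_real (r / norm (g i)) :: 'k) * (norm (g i))\<^sup>2"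
        unfolding y_def ip_scale_right norm_mult norm_conjg norm_ip_self ..
      also have "\<dots> = r * norm (g i)"
        unfolding norm_of_real using r by (simp add: power2_eq_square)
      finally show ?thesis .
    qed
    ultimately show ?thesis using r by (simp add: field_simps)
  qed (use r in simp)
  then show ?thesis by (auto simp: bounded_iff)
qed

text \<open>Indices are picked one at a time, each vector nearly orthogonal to the sum so far. A
  step adds at most \<open>C\<^sup>2\<close> for the new vector and 2 for the cross terms, so the
  squared norm grows only linearly in \<open>N\<close>. Any infinite \<open>I\<close> is allowed, so
  that subsequences are covered.\<close>

lemma sum_square_le_card:
  fixes g :: "nat \<Rightarrow> 'a"
  assumes bound: "\<And>i. norm (g i) \<le> C"
    and orth: "\<And>j. (\<lambda>i. ip (g i) (g j)) \<longlonglongrightarrow> 0"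
    and "infinite I"
  shows "\<exists>A\<subseteq>I. finite A \<and> card A = N \<and> (norm (\<Sum>i\<in>A. g i))\<^sup>2 \<le> real N * (C\<^sup>2 + 2)"
proof (induction N)
  case (Suc N)
  then obtain A where A: "A \<subseteq> I" "finite A" "card A = N"
      "(norm (\<Sum>i\<in>A. g i))\<^sup>2 \<le> real N * (C\<^sup>2 + 2)"
    by blast
  have "(\<lambda>i. ip (g i) (\<Sum>j\<in>A. g j)) \<longlonglongrightarrow> 0"
    using tendsto_sum[of A "\<lambda>j i. ip (g i) (g j)" "\<lambda>_. 0" sequentially] orth
    by (simp add: ip_sum_right)
  then have "\<forall>\<^sub>F i in sequentially. norm (ip (g i) (\<Sum>j\<in>A. g j)) < 1"
    by (auto dest: tendstoD[where e = 1])
  then obtain n where n: "\<And>i. i \<ge> n \<Longrightarrow> norm (ip (g i) (\<Sum>j\<in>A. g j)) < 1"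
    by (auto simp: eventually_sequentially)
  \<comment> \<open>Removing \<open>A\<close> makes the chosen index new, so the cardinality really
    grows.\<close>
  have "infinite (I - (A \<union> {..<n}))"
    using assms(3) A(2) by (metis Diff_infinite_finite finite_Un finite_lessThan)
  then obtain i where i: "i \<in> I" "i \<notin> A" "i \<ge> n"
    by (metis DiffE UnCI all_not_in_conv finite.emptyI lessThan_iff not_le)
  have "(norm ((\<Sum>j\<in>A. g j) + g i))\<^sup>2 \<le> real N * (C\<^sup>2 + 2) + 2 * 1 + C\<^sup>2"
    using norm_add_square_le[of "\<Sum>j\<in>A. g j" "g i"] A(4) n[OF i(3)]
      power_mono[OF bound[of i] norm_ge_zero, of 2] by linarith
  then have "(norm (\<Sum>j\<in>insert i A. g j))\<^sup>2 \<le> real (Suc N) * (C\<^sup>2 + 2)"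
    using A i by (simp add: algebra_simps)
  then show ?case
    using A i by (intro exI[of _ "insert i A"]) auto
qed auto

text \<open>Here \<open>p x\<close> stands for \<open>nrm (T x)\<close>, which keeps the target
  space out of the argument. Otherwise infinitely many \<open>g i\<close> would have
  \<open>p (g i) \<ge> \<epsilon>\<close> and be mutually \<open>p\<close>-close; sums of
  \<open>N\<close> of them would have \<open>p\<close> of order \<open>N\<close>, but norm only of
  order the square root of \<open>N\<close>.\<close>

lemma totally_bounded_seminorm_tendsto_0:
  fixes g :: "nat \<Rightarrow> 'a" and p :: "'a \<Rightarrow> real"
  assumes bound: "\<And>i. norm (g i) \<le> C"
    and orth: "\<And>j. (\<lambda>i. ip (g i) (g j)) \<longlonglongrightarrow> 0"
    and p_add: "\<And>x y. p (x + y) \<le> p x + p y"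
    and p_scaleR: "\<And>r x. p (r *\<^sub>R x) = \<bar>r\<bar> * p x"
    and p_le: "\<And>x. p x \<le> M * norm x"
    and net: "\<And>\<epsilon>. \<epsilon> > 0 \<Longrightarrow> \<exists>K. finite K \<and> (\<forall>i. \<exists>k\<in>K. p (k - g i) < \<epsilon>)"
  shows "(\<lambda>i. p (g i)) \<longlonglongrightarrow> 0"
proof -
  have p0: "p 0 = 0" using p_scaleR[of 0 0] by simp
  have p_minus: "p (- x) = p x" for x using p_scaleR[of "-1" x] by simp
  have p_ge: "p x \<ge> 0" for x using p_add[of x "- x"] by (simp add: p0 p_minus)
  have p_sum: "p (\<Sum>i\<in>A. h i) \<le> (\<Sum>i\<in>A. p (h i))" for A and h :: "nat \<Rightarrow> 'a"
  proof (induction A rule: infinite_finite_induct)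
    case (insert x F)
    then show ?case using p_add[of "h x" "sum h F"] by simp
  qed (simp_all add: p0)
  have "eventually (\<lambda>i. p (g i) < \<epsilon>) sequentially" if "\<epsilon> > 0" for \<epsilon>
  proof (rule ccontr)
    assume neg: "\<not> ?thesis"
    define J where "J = {i. p (g i) \<ge> \<epsilon>}"
    have J: "infinite J"
      using neg
      by (simp add: J_def not_le not_less not_eventually cofinite_eq_sequentially
          flip: frequently_cofinite)
    obtain K where K: "finite K" "\<And>i. \<exists>k\<in>K. p (k - g i) < \<epsilon> / 4"
      using net[of "\<epsilon> / 4"] \<open>\<epsilon> > 0\<close> by auto
    \<comment> \<open>Finitely many centres serve infinitely many indices, so one centre serves
      infinitely many; two indices sharing it are within \<open>\<epsilon> / 2\<close>.\<close>
    obtain k where k: "k \<in> K" "infinite {i\<in>J. p (k - g i) < \<epsilon> / 4}"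
      using pigeonhole_infinite_rel[OF J K(1), of "\<lambda>i k. p (k - g i) < \<epsilon> / 4"] K(2) by auto
    define I where "I = {i\<in>J. p (k - g i) < \<epsilon> / 4}"
    have close: "p (g i - g j) \<le> \<epsilon> / 2" if "i \<in> I" "j \<in> I" for i j
    proof -
      have "p (g i - g j) \<le> p (g i - k) + p (k - g j)"
        using p_add[of "g i - k" "k - g j"] by simp
      moreover have "p (g i - k) = p (k - g i)"
        using p_minus[of "k - g i"] by simp
      ultimately show ?thesis using that by (simp add: I_def)
    qed
    obtain i where i: "i \<in> I"
      using k(2) by (metis I_def all_not_in_conv finite.emptyI)
    have key: "real N * (\<epsilon> / 2)\<^sup>2 \<le> M\<^sup>2 * (C\<^sup>2 + 2)" if "N > 0" for N
    proof -
      obtain A where A: "A \<subseteq> I" "finite A" "card A = N"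
          "(norm (\<Sum>i\<in>A. g i))\<^sup>2 \<le> real N * (C\<^sup>2 + 2)"
        using sum_square_le_card[of g C I N] bound orth k(2) by (auto simp: I_def)
      have "real N * \<epsilon> \<le> p (real N *\<^sub>R g i)"
        using i by (simp add: p_scaleR I_def J_def mult_left_mono)
      \<comment> \<open>The sum over \<open>A\<close> is compared with \<open>N\<close> copies of
        the single vector \<open>g i\<close>; the differences cost at most half of
        \<open>real N * \<epsilon>\<close>.\<close>
      also have "real N *\<^sub>R g i = (\<Sum>j\<in>A. g i - g j) + (\<Sum>j\<in>A. g j)"
        by (simp add: A sum_subtractf sum_constant_scaleR)
      also have "p \<dots> \<le> p (\<Sum>j\<in>A. g i - g j) + p (\<Sum>j\<in>A. g j)"
        by (rule p_add)
      also have "p (\<Sum>j\<in>A. g i - g j) \<le> (\<Sum>j\<in>A. \<epsilon> / 2)"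
        using A(1) i by (intro order_trans[OF p_sum] sum_mono close) auto
      finally have "real N * (\<epsilon> / 2) \<le> p (\<Sum>j\<in>A. g j)"
        by (simp add: A(3))
      also have "\<dots> \<le> M * norm (\<Sum>j\<in>A. g j)"
        by (rule p_le)
      finally have "(real N * (\<epsilon> / 2))\<^sup>2 \<le> (M * norm (\<Sum>j\<in>A. g j))\<^sup>2"
        using \<open>\<epsilon> > 0\<close> by (intro power_mono) auto
      also have "\<dots> \<le> M\<^sup>2 * (real N * (C\<^sup>2 + 2))"
        unfolding power_mult_distrib by (intro mult_left_mono A) auto
      finally have "real N * (real N * (\<epsilon> / 2)\<^sup>2) \<le> real N * (M\<^sup>2 * (C\<^sup>2 + 2))"
        by (simp only: power_mult_distrib power2_eq_square mult_ac)
      then show ?thesis using that by (simp only: mult_le_cancel_left_pos of_nat_0_less_iff)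
    qed
    obtain N where N: "M\<^sup>2 * (C\<^sup>2 + 2) < real N * (\<epsilon> / 2)\<^sup>2"
      using reals_Archimedean3[of "(\<epsilon> / 2)\<^sup>2"] \<open>\<epsilon> > 0\<close> by auto
    then have "N > 0"
      by (metis gr0I mult_eq_0_iff of_nat_0 not_less zero_le_mult_iff zero_le_power2 add_nonneg_nonneg
          zero_le_numeral)
    with key N show False by (meson not_le)
  qed
  then show ?thesis
    by (auto intro!: tendstoI simp: p_ge)
qed

end

section \<open>Compactness as total boundedness, expressed in the domain\<close>

section \<open>Compact operators\<close>

lemma (in normed_space_on) dist_on_image:
  assumes T: "\<And>x. T x \<in> carrier Y" and add: "\<And>x y. T (x + y) = T x \<oplus> T y"
  shows "dist_on Y nrm (T x) (T y) = nrm (T (x - y :: 'b::ab_group_add))"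
proof -
  have "T x = T (x - y) \<oplus> T y"
    by (simp flip: add)
  then have "T x \<ominus> T y = T (x - y)"
    using T by (simp add: M.minus_eq M.a_assoc M.r_neg)
  with T show ?thesis by (simp add: dist_on_def)
qed

lemma (in banach_space_on) compact_operator_iff:
  "compact_operator sc Y nrm T \<longleftrightarrow> linear_into sc Y T \<and>
    (\<forall>B. bounded B \<longrightarrow> (\<forall>\<epsilon>>0. \<exists>K. finite K \<and> K \<subseteq> B \<and> (\<forall>x\<in>B. \<exists>k\<in>K. nrm (T (k - x)) < \<epsilon>)))"
proof (cases "linear_into sc Y T")
  case True
  interpret Y: Metric_space "carrier Y" "dist_on Y nrm"
    by (rule metric_space_dist_on)
  have T: "T x \<in> carrier Y" and dist_T: "dist_on Y nrm (T x) (T y) = nrm (T (x - y))" for x y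
    using True by (auto simp: linear_into_def intro!: dist_on_image)
  have "Y.mtotally_bounded (T ` B) \<longleftrightarrow>
      (\<forall>\<epsilon>>0. \<exists>K. finite K \<and> K \<subseteq> B \<and> (\<forall>x\<in>B. \<exists>k\<in>K. nrm (T (k - x)) < \<epsilon>))" for B
  proof -
    have "(\<exists>L. finite L \<and> L \<subseteq> T ` B \<and> T ` B \<subseteq> (\<Union>y\<in>L. Y.mball y \<epsilon>)) \<longleftrightarrow>
        (\<exists>K. finite K \<and> K \<subseteq> B \<and> (\<forall>x\<in>B. \<exists>k\<in>K. nrm (T (k - x)) < \<epsilon>))" for \<epsilon>
    proof -
      have "(\<exists>L. finite L \<and> L \<subseteq> T ` B \<and> T ` B \<subseteq> (\<Union>y\<in>L. Y.mball y \<epsilon>)) \<longleftrightarrow>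
          (\<exists>K. finite K \<and> K \<subseteq> B \<and> T ` B \<subseteq> (\<Union>y\<in>T ` K. Y.mball y \<epsilon>))"
        by (metis finite_imageI finite_subset_image image_mono)
      also have "\<dots> \<longleftrightarrow> (\<exists>K. finite K \<and> K \<subseteq> B \<and> (\<forall>x\<in>B. \<exists>k\<in>K. nrm (T (k - x)) < \<epsilon>))"
        by (simp add: image_subset_iff T dist_T Bex_def)
      finally show ?thesis .
    qed
    then show ?thesis by (simp add: Y.mtotally_bounded_def)
  qed
  moreover have "Y.mtotally_bounded (T ` B) \<longleftrightarrow>
      compactin Y.mtopology (Abstract_Topology.closure_of Y.mtopology (T ` B))" for B
    using Y.mtotally_bounded_eq_compact_closure_of[OF complete, of "T ` B"] T by auto
  ultimately show ?thesis
    using True by (simp add: compact_operator_def)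
qed (simp add: compact_operator_def)

section \<open>A copy of the scalar field inside \<open>'u\<close>, and the functionals into
  it\<close>

section \<open>The scalar field as a target space\<close>

text \<open>The components \<open>mult\<close> and \<open>one\<close> of the ring record play no role in a module. The notation
  \<open>inv\<close> is taken by HOL-Algebra, hence \<open>inv_into UNIV\<close>.\<close>

definition scalars_on :: "('k::real_or_complex \<Rightarrow> 'u) \<Rightarrow> ('k, 'u) module" where
  "scalars_on e = \<lparr>carrier = range e,
     monoid.mult = (\<lambda>x y. e (inv_into UNIV e x * inv_into UNIV e y)), one = e 1, ring.zero = e 0,
     add = (\<lambda>x y. e (inv_into UNIV e x + inv_into UNIV e y)),
     smult = (\<lambda>c x. e (c * inv_into UNIV e x))\<rparr>"

lemma cring_scalar_ring: "cring (scalar_ring :: 'k::real_or_complex ring)"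
proof (rule cringI)
  show "abelian_group (scalar_ring :: 'k ring)"
    by (rule abelian_groupI) (auto simp: scalar_ring_def intro: exI[of _ "- _"])
  show "comm_monoid (scalar_ring :: 'k ring)"
    by (rule comm_monoidI) (auto simp: scalar_ring_def)
qed (auto simp: scalar_ring_def algebra_simps)

lemma normed_space_scalars_on:
  fixes e :: "'k::real_or_complex \<Rightarrow> 'u"
  assumes "inj e"
  shows "normed_space_on (scalars_on e) (\<lambda>x. norm (inv_into UNIV e x))"
proof -
  have [simp]: "inv_into UNIV e (e x) = x" for x using assms by simp
  have "abelian_group (scalars_on e)"
    by (rule abelian_groupI)
      (auto simp: scalars_on_def algebra_simps inj_eq[OF assms] intro: exI[of _ "- _"])
  then have "Module.module scalar_ring (scalars_on e)"
    by (intro moduleI cring_scalar_ring) (auto simp: scalar_ring_def scalars_on_def algebra_simps)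
  then show ?thesis
    by (intro normed_space_on.intro normed_space_on_axioms.intro)
      (auto simp: scalars_on_def inj_eq[OF assms] norm_mult norm_triangle_ineq)
qed

lemma banach_space_scalars_on:
  fixes e :: "'k::real_or_complex \<Rightarrow> 'u"
  assumes "inj e"
  shows "banach_space_on (scalars_on e) (\<lambda>x. norm (inv_into UNIV e x))"
proof -
  interpret normed_space_on "scalars_on e" "\<lambda>x. norm (inv_into UNIV e x)"
    by (rule normed_space_scalars_on[OF assms])
  let ?d = "dist_on (scalars_on e) (\<lambda>x. norm (inv_into UNIV e x))"
  interpret Y: Metric_space "carrier (scalars_on e)" ?d
    by (rule metric_space_dist_on)
  have [simp]: "inv_into UNIV e (e x) = x" for x using assms by simp
  have carrier: "carrier (scalars_on e) = range e" by (simp add: scalars_on_def)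
  \<comment> \<open>The map \<open>e\<close> is an isometry onto the carrier, which carries
    completeness over from the scalars.\<close>
  have d: "?d (e x) (e y) = dist x y" for x y
  proof -
    have "?d (e x) (e y) = norm (inv_into UNIV e (e (x - y)))"
      by (rule dist_on_image) (simp_all add: scalars_on_def)
    then show ?thesis by (simp add: dist_norm)
  qed
  have "\<exists>x. limitin Y.mtopology \<sigma> x sequentially" if \<sigma>: "Y.MCauchy \<sigma>" for \<sigma>
  proof -
    have "range \<sigma> \<subseteq> range e"
      using \<sigma> unfolding Y.MCauchy_def by (simp add: carrier)
    then have "\<forall>n. \<exists>x. \<sigma> n = e x"
      by blast
    then obtain s where s: "\<And>n. \<sigma> n = e (s n)"
      by metis
    have "Cauchy s"
      using \<sigma> unfolding Y.MCauchy_def by (simp add: s d Cauchy_def)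
    then obtain l where "s \<longlonglongrightarrow> l"
      using Cauchy_convergent unfolding convergent_def by blast
    then have "limitin Y.mtopology \<sigma> (e l) sequentially"
      unfolding Y.limitin_metric tendsto_iff by (simp add: s d carrier)
    then show ?thesis by blast
  qed
  then have "Y.mcomplete" by (simp add: Y.mcomplete_def)
  then show ?thesis
    by (intro banach_space_on.intro banach_space_on_axioms.intro normed_space_on_axioms)
qed

text \<open>By Cauchy-Schwarz the functional maps bounded sets to bounded sets of scalars, and these
  are totally bounded.\<close>

lemma (in hilbert_space) compact_operator_ip:
  fixes e :: "'k \<Rightarrow> 'u"
  assumes "inj e"
  shows "compact_operator sc (scalars_on e) (\<lambda>x. norm (inv_into UNIV e x)) (\<lambda>x. e (ip x f))"
proof -
  interpret Y: banach_space_on "scalars_on e" "\<lambda>x. norm (inv_into UNIV e x)"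
    by (rule banach_space_scalars_on[OF assms])
  have [simp]: "inv_into UNIV e (e x) = x" for x using assms by simp
  have "linear_into sc (scalars_on e) (\<lambda>x. e (ip x f))"
    by (auto simp: linear_into_def scalars_on_def ip_add_left ip_scale_left)
  moreover have "\<exists>K. finite K \<and> K \<subseteq> B \<and> (\<forall>x\<in>B. \<exists>k\<in>K. norm (ip (k - x) f) < \<epsilon>)"
    if "bounded B" "\<epsilon> > 0" for B and \<epsilon> :: real
  proof -
    obtain b where b: "\<And>x. x \<in> B \<Longrightarrow> norm x \<le> b"
      using \<open>bounded B\<close> by (auto simp: bounded_iff)
    have "bounded ((\<lambda>x. ip x f) ` B)"
      unfolding bounded_iff
    proof (intro exI ballI)
      fix y assume "y \<in> (\<lambda>x. ip x f) ` B"
      then obtain x where "x \<in> B" "y = ip x f" by blast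
      then show "norm y \<le> b * norm f"
        using cauchy_schwarz[of x f] mult_right_mono[OF b norm_ge_zero, of x f] by simp
    qed
    from bounded_scalars_net[OF this \<open>\<epsilon> > 0\<close>] obtain L where L: "finite L" "L \<subseteq> (\<lambda>x. ip x f) ` B"
      "\<forall>y\<in>(\<lambda>x. ip x f) ` B. \<exists>k\<in>L. dist k y < \<epsilon>" by blast
    then obtain K where "K \<subseteq> B" "finite K" "L = (\<lambda>x. ip x f) ` K"
      by (metis finite_subset_image)
    with L show ?thesis
      by (intro exI[of _ K]) (auto simp: dist_norm ip_diff_left)
  qed
  ultimately show ?thesis
    by (simp add: Y.compact_operator_iff)
qed

section \<open>The two directions of the equivalence\<close>

section \<open>Admissible sequences\<close>

text \<open>Replaces a supremum over \<open>F i\<close> by the value at one member, so that facts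
  about sequences apply.\<close>

lemma near_maximizer:
  fixes h :: "'b \<Rightarrow> real"
  assumes "A \<noteq> {}" "bdd_above (h ` A)" "0 < \<epsilon>"
  shows "\<exists>g\<in>A. \<forall>f\<in>A. h f \<le> h g + \<epsilon>"
proof -
  have "\<exists>g\<in>A. Sup (h ` A) - \<epsilon> < h g"
    using less_cSup_iff[of "h ` A" "Sup (h ` A) - \<epsilon>"] assms by auto
  moreover have "h f \<le> Sup (h ` A)" if "f \<in> A" for f
    using assms that by (simp add: cSup_upper)
  ultimately show ?thesis by force
qed

text \<open>Admissibility is tested on the functional given by \<open>f\<close>. Allowing every
  \<open>f\<close> in the space, not only members of the \<open>F i\<close>, is what uniform
  boundedness requires later.\<close>

lemma (in hilbert_space) admissible_imp_weakly_null:
  fixes e :: "'k \<Rightarrow> 'u"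
  assumes "inj e" and "admissible TYPE('u) sc F" and "\<And>i. g i \<in> F i"
  shows "(\<lambda>i. ip (g i) f) \<longlonglongrightarrow> 0"
proof (rule tendstoI)
  fix \<epsilon> :: real assume "\<epsilon> > 0"
  have "limsup (\<lambda>i. SUP h\<in>F i. ereal (norm (inv_into UNIV e (e (ip h f))))) = 0"
    using assms(2) banach_space_scalars_on[OF assms(1)] compact_operator_ip[OF assms(1)]
    unfolding admissible_def by blast
  then have "limsup (\<lambda>i. SUP h\<in>F i. ereal (norm (ip h f))) \<le> 0"
    using assms(1) by simp
  then have "\<forall>\<^sub>F i in sequentially. (SUP h\<in>F i. ereal (norm (ip h f))) < ereal \<epsilon>"
    using \<open>\<epsilon> > 0\<close> by (auto simp: Limsup_le_iff)
  then show "\<forall>\<^sub>F i in sequentially. dist (ip (g i) f) 0 < \<epsilon>"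
  proof eventually_elim
    case (elim i)
    have "ereal (norm (ip (g i) f)) \<le> (SUP h\<in>F i. ereal (norm (ip h f)))"
      by (intro SUP_upper assms)
    with elim have "ereal (norm (ip (g i) f)) < ereal \<epsilon>" by (rule le_less_trans[rotated])
    then show ?case by simp
  qed
qed

text \<open>The bounds of the single sets might grow with \<open>i\<close>. Vectors within 1 of the
  largest norm in each \<open>F i\<close> form a weakly null, hence bounded, sequence, which
  controls all sets at once.\<close>

lemma (in hilbert_space) admissible_imp_bounded:
  fixes e :: "'k \<Rightarrow> 'u"
  assumes "inj e" and "admissible TYPE('u) sc F"
    and "\<And>i. F i \<noteq> {}" and "\<And>i. bounded (F i)"
  shows "bounded (\<Union>i. F i)"
proof -
  have "\<exists>g\<in>F i. \<forall>f\<in>F i. norm f \<le> norm g + 1" for i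
  proof (rule near_maximizer)
    show "bdd_above (norm ` F i)" using assms(4)[of i] by (auto simp: bounded_iff bdd_above_def)
  qed (use assms in auto)
  then obtain g where g: "\<And>i. g i \<in> F i" "\<And>i f. f \<in> F i \<Longrightarrow> norm f \<le> norm (g i) + 1"
    by metis
  have "bounded (range (\<lambda>i. ip (g i) x))" for x
    using admissible_imp_weakly_null[OF assms(1,2) g(1)]
    by (intro convergent_imp_bounded)
  then have "bounded (range g)" by (rule pointwise_bounded_imp_bounded)
  then obtain b where "\<And>i. norm (g i) \<le> b" by (auto simp: bounded_iff)
  then have "norm f \<le> b + 1" if "f \<in> F i" for f i
    using g(2)[OF that] by (meson add_right_mono order_trans)
  then show ?thesis by (auto simp: bounded_iff)
qed

lemma (in hilbert_space) asymptotically_orthogonal_imp_admissible: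
  assumes "bounded (\<Union>i. F i)" and "\<And>i. F i \<noteq> {}"
    and orth: "\<And>f g. f \<in> (\<Union>i. F i) \<Longrightarrow> (\<And>i. g i \<in> F i) \<Longrightarrow> (\<lambda>i. ip (g i) f) \<longlonglongrightarrow> 0"
  shows "admissible TYPE('u) sc F"
  unfolding admissible_def
proof (intro allI impI)
  fix Y :: "('k, 'u) module" and nrm T
  assume "banach_space_on Y nrm" and T: "compact_operator sc Y nrm T"
  then interpret Y: banach_space_on Y nrm by blast
  have lin: "linear_into sc Y T"
    and net: "\<And>B \<epsilon>. bounded B \<Longrightarrow> \<epsilon> > 0 \<Longrightarrow>
      \<exists>K. finite K \<and> K \<subseteq> B \<and> (\<forall>x\<in>B. \<exists>k\<in>K. nrm (T (k - x)) < \<epsilon>)"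
    using T by (auto simp: Y.compact_operator_iff)
  define p where "p x = nrm (T x)" for x
  have Tc: "T x \<in> carrier Y" for x using lin by (simp add: linear_into_def)
  have p_add: "p (x + y) \<le> p x + p y" for x y
    using lin Y.nrm_triangle[OF Tc Tc, of x y] by (simp add: p_def linear_into_def)
  have p_scaleR: "p (r *\<^sub>R x) = \<bar>r\<bar> * p x" for r x
  proof -
    have "T (r *\<^sub>R x) = of_real r \<odot>\<^bsub>Y\<^esub> T x"
      using lin by (metis linear_into_def scale_of_real)
    then show ?thesis by (simp add: p_def Y.nrm_smult Tc)
  qed
  have p0: "p 0 = 0" using p_scaleR[of 0 0] by simp
  have p_minus: "p (- x) = p x" for x using p_scaleR[of "-1" x] by simp
  have p_ge: "p x \<ge> 0" for x using p_add[of x "- x"] by (simp add: p0 p_minus)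
  \<comment> \<open>A compact operator is bounded: a finite 1-net of the unit ball bounds
    \<open>p\<close> there, and homogeneity does the rest.\<close>
  obtain M where M: "\<And>x. p x \<le> M * norm x"
  proof -
    obtain K where K: "finite K" "\<And>x. norm x \<le> 1 \<Longrightarrow> \<exists>k\<in>K. p (k - x) < 1"
      using net[of "cball 0 1" 1] by (auto simp: p_def)
    define M where "M = Max (insert 0 (p ` K)) + 1"
    have unit: "p x \<le> M" if "norm x \<le> 1" for x
    proof -
      obtain k where k: "k \<in> K" "p (k - x) < 1" using K(2) \<open>norm x \<le> 1\<close> by blast
      have "p k \<le> Max (insert 0 (p ` K))" using k K by (intro Max_ge) auto
      then show ?thesis
        using p_add[of k "- (k - x)"] k by (simp only: p_minus M_def) simp
    qed
    have "p x \<le> M * norm x" for x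
    proof (cases "x = 0")
      case False
      then have "p (norm x *\<^sub>R (inverse (norm x) *\<^sub>R x)) \<le> norm x * M"
        unfolding p_scaleR[of "norm x"] by (simp only: abs_norm_cancel) (intro mult_left_mono unit; simp)
      then show ?thesis using False by (simp add: mult.commute)
    qed (simp add: p0)
    then show ?thesis using that by blast
  qed
  obtain C where C: "\<And>i f. f \<in> F i \<Longrightarrow> norm f \<le> C"
    using assms(1) by (auto simp: bounded_iff)
  have "bdd_above (p ` F i)" for i
  proof (rule bdd_aboveI2)
    fix f assume "f \<in> F i"
    have "p f \<le> \<bar>M\<bar> * norm f" using M[of f] by (meson abs_ge_self mult_right_mono norm_ge_zero order_trans)
    also have "\<dots> \<le> \<bar>M\<bar> * C" using C \<open>f \<in> F i\<close> by (intro mult_left_mono) auto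
    finally show "p f \<le> \<bar>M\<bar> * C" .
  qed
  \<comment> \<open>The slack tends to 0, so the suprema tend to 0 as soon as \<open>p (g i)\<close>
    does.\<close>
  then have "\<exists>g\<in>F i. \<forall>f\<in>F i. p f \<le> p g + inverse (real (Suc i))" for i
    by (intro near_maximizer assms) auto
  then obtain g where g: "\<And>i. g i \<in> F i"
      "\<And>i f. f \<in> F i \<Longrightarrow> p f \<le> p (g i) + inverse (real (Suc i))"
    by metis
  have "(\<lambda>i. p (g i)) \<longlonglongrightarrow> 0"
  proof (rule totally_bounded_seminorm_tendsto_0[where C = C and M = M])
    show "\<exists>K. finite K \<and> (\<forall>i. \<exists>k\<in>K. p (k - g i) < \<epsilon>)" if "\<epsilon> > 0" for \<epsilon>
    proof -
      have "bounded (range g)" using C g(1) by (force simp: bounded_iff)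
      from net[OF this that] show ?thesis by (auto simp: p_def)
    qed
  qed (use C g orth p_add p_scaleR M in blast)+
  then have "(\<lambda>i. p (g i) + inverse (real (Suc i))) \<longlonglongrightarrow> 0 + 0"
    by (intro tendsto_add LIMSEQ_inverse_real_of_nat)
  then have upper: "(\<lambda>i. ereal (p (g i) + inverse (real (Suc i)))) \<longlonglongrightarrow> 0"
    by (simp add: zero_ereal_def)
  have "(\<lambda>i. SUP f\<in>F i. ereal (p f)) \<longlonglongrightarrow> 0"
  proof (rule tendsto_sandwich[OF _ _ tendsto_const upper])
    \<comment> \<open>The member \<open>g i\<close> matters: in \<open>ereal\<close> the supremum of
      the empty set is minus infinity.\<close>
    show "\<forall>\<^sub>F i in sequentially. 0 \<le> (SUP f\<in>F i. ereal (p f))"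
      using g(1) p_ge by (intro always_eventually allI SUP_upper2) auto
    show "\<forall>\<^sub>F i in sequentially. (SUP f\<in>F i. ereal (p f)) \<le> ereal (p (g i) + inverse (real (Suc i)))"
      using g(2) by (intro always_eventually allI SUP_least) simp
  qed
  then show "limsup (\<lambda>i. SUP f\<in>F i. ereal (nrm (T f))) = 0"
    by (simp add: p_def lim_imp_Limsup)
qed

text \<open>Nonemptiness excludes the value minus infinity, so a supremum below infinity is a real
  bound.\<close>

lemma SUP_norm_finite_iff_bounded:
  assumes "\<And>i. F i \<noteq> {}"
  shows "(SUP i. SUP f\<in>F i. ereal (norm f)) < \<infinity> \<longleftrightarrow> bounded (\<Union>i. F i)"
proof
  assume *: "(SUP i. SUP f\<in>F i. ereal (norm f)) < \<infinity>" (is "?S < \<infinity>")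
  have le: "ereal (norm f) \<le> ?S" if "f \<in> F i" for f i
    using that by (intro SUP_upper2[of i] SUP_upper) auto
  then obtain b where "?S = ereal b"
    using assms * by (cases ?S) fastforce+
  with le have "norm f \<le> b" if "f \<in> F i" for f i
    using that by fastforce
  then show "bounded (\<Union>i. F i)" by (auto simp: bounded_iff)
next
  assume "bounded (\<Union>i. F i)"
  then obtain b where "\<And>i f. f \<in> F i \<Longrightarrow> norm f \<le> b" by (auto simp: bounded_iff)
  then have "(SUP i. SUP f\<in>F i. ereal (norm f)) \<le> ereal b"
    by (intro SUP_least) simp
  then show "(SUP i. SUP f\<in>F i. ereal (norm f)) < \<infinity>" by (rule le_less_trans) simp
qed

text \<open>The map \<open>e\<close> provides a nonzero target space inside \<open>'u\<close>. A
  limsup ignores any single \<open>F i\<close>, so it could not detect one unbounded set; and one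
  empty set would leave no sequence \<open>g\<close>, making orthogonality vacuous.\<close>

theorem theorem4p1:
  fixes sc :: "'k::real_or_complex \<Rightarrow> 'a::banach \<Rightarrow> 'a"
    and ip :: "'a \<Rightarrow> 'a \<Rightarrow> 'k"
    and F :: "nat \<Rightarrow> 'a set"
    and e :: "'k \<Rightarrow> 'u"
  assumes "hilbert_space sc ip"
    and "\<And>i. F i \<noteq> {}"
    and "\<And>i. bounded (F i)"
    and "inj e"
  shows "admissible TYPE('u) sc F \<longleftrightarrow>
      (SUP i. SUP f\<in>F i. ereal (norm f)) < \<infinity> \<and>
      (\<forall>f\<in>\<Union>i. F i. \<forall>g. (\<forall>i. g i \<in> F i) \<longrightarrow> (\<lambda>i. ip (g i) f) \<longlonglongrightarrow> 0)"
proof -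
  interpret hilbert_space sc ip by fact
  show ?thesis
    unfolding SUP_norm_finite_iff_bounded[OF assms(2)]
    using admissible_imp_bounded[of e F] admissible_imp_weakly_null[of e F]
      asymptotically_orthogonal_imp_admissible[of F] assms
    by blast
qed

end
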